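(* Let $\Sigma\subset\mathbb{R}^{n+1}$ be an immersed submanifold with $\dim\Sigma>0$ and let $\nu\in\Gamma(N\Sigma)$ be a unit normal section. Assume that $\Phi_\nu(\Sigma)\subset T\mathbb{S}^n$ is immersed. Then $\Sigma$ is an orthogonal submanifold of $\Phi_\nu(\Sigma)$ and $\Phi_\nu(\Sigma)$ is isotropic.
   Context: "Smooth" means $C^2$. $\langle\cdot,\cdot\rangle$ is the Euclidean inner product. A subset $\mathcal N$ of a manifold $\mathcal M$ is immersed if $\mathcal N$ itself is a smooth manifold and the inclusion is a smooth immersion. Identify $T\mathbb{S}^n=\{(\xi,\eta)\in\mathbb{R}^{n+1}\times\mathbb{R}^{n+1}: |\xi|=1,\ \langle\xi,\eta\rangle=0\}$; $(\xi,\eta)$ corresponds to the oriented line $\{\eta+t\xi:t\in\mathbb{R}\}$. $\Phi_\nu:\Sigma\to T\mathbb{S}^n$ is $\Phi_\nu(q)=(\nu(q),q-\langle\nu(q),q\rangle\nu(q))$. Let $g$ be the round metric on $\mathbb{S}^n$ and $\pi:T\mathbb{S}^n\to\mathbb{S}^n$ the projection; the Liouville form is $\theta_{(\xi,\eta)}(X)=g_\xi(\mathrm{d}\pi(X),\eta)$ and $\Omega=-\mathrm{d}\theta$. An immersed submanifold $\Gamma\subseteq T\mathbb{S}^n$ is isotropic if $\Omega|_\Gamma=0$. An immersed submanifold $\Sigma\subset\mathbb{R}^{n+1}$ is an orthogonal submanifold of $\Gamma$ if $\dim\Sigma>0$ and there exists a smooth unit normal section $\nu\in\Gamma(N\Sigma)$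 with $\Phi_\nu(\Sigma)\subseteq\Gamma$. *)

theory Defs
  imports "HOL-Analysis.Analysis"
begin

section \<open>Manifolds of class C2\<close>

text \<open>
  The model space of a manifold of dimension \<open>k\<close> is a \<open>k\<close>-dimensional linear subspace of some
  Euclidean space, so that \<open>k\<close> is a number, possibly 0, rather than a type.
  \<open>C2_on U f\<close> is meant for sets \<open>U\<close> that are relatively open in such a subspace \<open>V\<close>. For these, the
  derivatives within \<open>U\<close> are determined on \<open>V\<close> (off \<open>V\<close> their values are irrelevant), and
  \<open>C2_on U f\<close> says that \<open>f\<close> is twice continuously differentiable as a function on an open
  subset of \<open>V\<close>.
\<close>

definition C2_on :: "'a::euclidean_space set \<Rightarrow> ('a \<Rightarrow> 'b::euclidean_space) \<Rightarrow> bool" where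
  "C2_on U f \<longleftrightarrow>
    (\<exists>(f' :: 'a \<Rightarrow> 'a \<Rightarrow>\<^sub>L 'b) (f'' :: 'a \<Rightarrow> 'a \<Rightarrow>\<^sub>L ('a \<Rightarrow>\<^sub>L 'b)).
      (\<forall>x\<in>U. (f has_derivative blinfun_apply (f' x)) (at x within U)) \<and>
      (\<forall>x\<in>U. (f' has_derivative blinfun_apply (f'' x)) (at x within U)) \<and>
      continuous_on U f'')"

text \<open>
  A chart is a pair \<open>(D, \<phi>)\<close> of a domain and a coordinate map; \<open>\<phi>\<close> is relevant only on \<open>D\<close>.
  The topology is part of the data: for an immersed subset of a Euclidean space it may be finer
  than the subspace topology.
\<close>

record ('p, 'm) manifold =
  topology_of :: "'p topology"
  model :: "'m set"
  atlas :: "('p set \<times> ('p \<Rightarrow> 'm)) set"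

abbreviation points :: "('p, 'm) manifold \<Rightarrow> 'p set" where
  "points N \<equiv> topspace (topology_of N)"

definition mdim :: "('p, 'm::euclidean_space) manifold \<Rightarrow> nat" where
  "mdim N = dim (model N)"

definition C2_manifold :: "('p, 'm::euclidean_space) manifold \<Rightarrow> bool" where
  "C2_manifold N \<longleftrightarrow>
    subspace (model N) \<and>
    Hausdorff_space (topology_of N) \<and>
    second_countable (topology_of N) \<and>
    (\<Union>(D, \<phi>)\<in>atlas N. D) = points N \<and>
    (\<forall>(D, \<phi>)\<in>atlas N.
      openin (topology_of N) D \<and>
      openin (top_of_set (model N)) (\<phi> ` D) \<and>
      homeomorphic_map (subtopology (topology_of N) D) (top_of_set (\<phi> ` D)) \<phi>) \<and>
    (\<forall>(D, \<phi>)\<in>atlas N. \<forall>(E, \<psi>)\<in>atlas N.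
      C2_on (\<phi> ` (D \<inter> E)) (\<psi> \<circ> inv_into D \<phi>))"

definition C2_map :: "('p, 'm::euclidean_space) manifold \<Rightarrow> ('p \<Rightarrow> 'e::euclidean_space) \<Rightarrow> bool" where
  "C2_map N F \<longleftrightarrow> (\<forall>(D, \<phi>)\<in>atlas N. C2_on (\<phi> ` D) (F \<circ> inv_into D \<phi>))"

definition C2_immersion :: "('p, 'm::euclidean_space) manifold \<Rightarrow> ('p \<Rightarrow> 'e::euclidean_space) \<Rightarrow> bool" where
  "C2_immersion N F \<longleftrightarrow>
    C2_map N F \<and>
    (\<forall>(D, \<phi>)\<in>atlas N. \<forall>x\<in>\<phi> ` D. \<exists>F'.
      ((F \<circ> inv_into D \<phi>) has_derivative F') (at x within \<phi> ` D) \<and> inj_on F' (model N))"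

text \<open>
  Here \<open>M\<close> is a Euclidean space or an embedded submanifold of one. In the latter case, the
  inclusion of \<open>N\<close> is a C2 immersion into \<open>M\<close> iff it is one into the surrounding Euclidean space.
\<close>

definition immersed_submanifold ::
    "('e, 'm::euclidean_space) manifold \<Rightarrow> 'e::euclidean_space set \<Rightarrow> bool" where
  "immersed_submanifold N M \<longleftrightarrow>
    C2_manifold N \<and> points N \<subseteq> M \<and> C2_immersion N (\<lambda>p. p)"

text \<open>The tangent space at \<open>p\<close>, as a subspace of the surrounding Euclidean space.\<close>

definition tangent_space ::
    "('e, 'm::euclidean_space) manifold \<Rightarrow> 'e::euclidean_space \<Rightarrow> 'e set" where
  "tangent_space N p =
    {f' v | f' v. v \<in> model N \<and>
      (\<exists>(D, \<phi>)\<in>atlas N. p \<in> D \<and> (inv_into D \<phi> has_derivative f') (at (\<phi> p) within \<phi> ` D))}"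

definition unit_normal_section ::
    "('e, 'm::euclidean_space) manifold \<Rightarrow> ('e \<Rightarrow> 'e::euclidean_space) \<Rightarrow> bool" where
  "unit_normal_section S \<nu> \<longleftrightarrow>
    C2_map S \<nu> \<and>
    (\<forall>q\<in>points S. norm (\<nu> q) = 1 \<and> (\<forall>u\<in>tangent_space S q. \<nu> q \<bullet> u = 0))"


section \<open>The space of oriented lines\<close>

definition TSn :: "('a::euclidean_space \<times> 'a) set" where
  "TSn = {(\<xi>, \<eta>). norm \<xi> = 1 \<and> \<xi> \<bullet> \<eta> = 0}"

definition normal_lines :: "('a \<Rightarrow> 'a) \<Rightarrow> 'a \<Rightarrow> 'a::euclidean_space \<times> 'a" where
  "normal_lines \<nu> q = (\<nu> q, q - (\<nu> q \<bullet> q) *\<^sub>R \<nu> q)"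

text \<open>
  The exterior derivative of a 1-form on a Euclidean space. The first argument of a form is the
  base point.
\<close>

definition ext_deriv :: "('e::euclidean_space \<Rightarrow> 'e \<Rightarrow> real) \<Rightarrow> 'e \<Rightarrow> 'e \<Rightarrow> 'e \<Rightarrow> real" where
  "ext_deriv \<alpha> p u v =
    frechet_derivative (\<lambda>q. \<alpha> q v) (at p) u - frechet_derivative (\<lambda>q. \<alpha> q u) (at p) v"

text \<open>
  The bundle projection is the restriction of the linear map \<open>fst\<close>, hence so is its differential,
  and the round metric is the restriction of the inner product. The formula for the Liouville form
  thus makes sense on the whole surrounding space. Since the exterior derivative commutes with
  restriction to the submanifold \<open>TSn\<close>, on tangent vectors of \<open>TSn\<close> the form \<open>\<Omega>\<close> below is minus
  the exterior derivative of the Liouville form of \<open>TSn\<close>.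
\<close>

definition liouville :: "'a::euclidean_space \<times> 'a \<Rightarrow> 'a \<times> 'a \<Rightarrow> real" where
  "liouville p X = fst X \<bullet> snd p"

definition \<Omega> :: "'a::euclidean_space \<times> 'a \<Rightarrow> 'a \<times> 'a \<Rightarrow> 'a \<times> 'a \<Rightarrow> real" where
  "\<Omega> p X Y = - ext_deriv liouville p X Y"

lemma \<Omega>_eq: "\<Omega> p X Y = fst X \<bullet> snd Y - fst Y \<bullet> snd X"
proof -
  have "((\<lambda>q. liouville q Z) has_derivative (\<lambda>W. fst Z \<bullet> snd W)) (at p)" for Z :: "'a \<times> 'a"
    unfolding liouville_def by (auto intro!: derivative_eq_intros)
  then have "frechet_derivative (\<lambda>q. liouville q Z) (at p) = (\<lambda>W. fst Z \<bullet> snd W)" for Z :: "'a \<times> 'a"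
    by (metis frechet_derivative_at)
  then show ?thesis
    by (simp add: \<Omega>_def ext_deriv_def)
qed

definition isotropic :: "('a::euclidean_space \<times> 'a, 'm::euclidean_space) manifold \<Rightarrow> bool" where
  "isotropic \<Gamma> \<longleftrightarrow>
    immersed_submanifold \<Gamma> TSn \<and>
    (\<forall>p\<in>points \<Gamma>. \<forall>X\<in>tangent_space \<Gamma> p. \<forall>Y\<in>tangent_space \<Gamma> p. \<Omega> p X Y = 0)"

definition orthogonal_submanifold ::
    "('a::euclidean_space, 'k::euclidean_space) manifold \<Rightarrow>
     ('a \<times> 'a, 'm::euclidean_space) manifold \<Rightarrow> bool" where
  "orthogonal_submanifold S \<Gamma> \<longleftrightarrow>
    immersed_submanifold S UNIV \<and> immersed_submanifold \<Gamma> TSn \<and>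
    mdim S > 0 \<and>
    (\<exists>\<nu>. unit_normal_section S \<nu> \<and> normal_lines \<nu> ` points S \<subseteq> points \<Gamma>)"

end

theory Submission
  imports Defs
begin

text \<open>
  Differentiating \<open>\<nu> \<bullet> \<nu> = 1\<close> and using that \<open>\<nu>\<close> is normal, one sees that \<open>\<Phi> = normal_lines \<nu>\<close> is an
  immersion and that \<open>\<Omega>\<close> vanishes on the image of its differential; the latter amounts to the symmetry
  of the second fundamental form in direction \<open>\<nu>\<close>, that is, of second derivatives of parametrizations.
  It remains to show that tangent vectors of \<open>\<Gamma>\<close> come from tangent vectors of \<open>S\<close>, although \<open>\<Phi>\<close> need
  not be continuous for the possibly finer topology of \<open>\<Gamma>\<close>. Now \<open>\<Gamma>\<close> is covered by countably many
  compact pieces on which \<open>\<Phi>\<close> has a Lipschitz inverse. A curve in such a piece lifts to \<open>S\<close>, so its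
  velocity lies in the image of the differential. By Baire's theorem, the pieces have interior points
  in every open subset of a chart of \<open>\<Gamma>\<close>. Hence \<open>\<Omega>\<close> vanishes on a dense set of tangent spaces, and
  by continuity on all of them.
\<close>

section \<open>Derivatives on open subsets of a subspace\<close>

lemma subspace_openin_line:
  fixes V :: "'a::real_normed_vector set"
  assumes V: "subspace V" and U: "openin (top_of_set V) U" and "x \<in> U" "v \<in> V"
  obtains \<delta> where "\<delta> > 0" "\<And>t. \<bar>t\<bar> < \<delta> \<Longrightarrow> x + t *\<^sub>R v \<in> U"
proof -
  obtain W where W: "open W" "U = V \<inter> W"
    using U by (auto simp: openin_open)
  have "continuous_on UNIV (\<lambda>t. x + t *\<^sub>R v)"
    by (intro continuous_intros)
  then have "open ((\<lambda>t. x + t *\<^sub>R v) -` W)"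
    using W(1) by (simp add: continuous_on_open_vimage)
  moreover have "0 \<in> (\<lambda>t. x + t *\<^sub>R v) -` W"
    using W(2) assms(3) by simp
  ultimately obtain \<delta> where "\<delta> > 0" "ball 0 \<delta> \<subseteq> (\<lambda>t. x + t *\<^sub>R v) -` W"
    using open_contains_ball by blast
  moreover have "x + t *\<^sub>R v \<in> V" for t
    using V W assms by (auto intro: subspace_add subspace_scale)
  ultimately show ?thesis
    using W(2) by (intro that[of \<delta>]) (auto simp: subset_iff dist_norm)
qed

text \<open>\<open>U\<close> may have empty interior in the surrounding space, so a derivative
  within \<open>U\<close> is used through its restriction to lines in directions of
  \<open>V\<close>. These stay in \<open>U\<close> for a short time and give ordinary derivatives in
  one real variable.\<close>

lemma has_vector_derivative_along_line:
  fixes V :: "'a::real_normed_vector set"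
  assumes "subspace V" and "openin (top_of_set V) U" and "x + s *\<^sub>R v \<in> U" "v \<in> V"
    and f: "(f has_derivative f') (at (x + s *\<^sub>R v) within U)"
  shows "((\<lambda>t. f (x + t *\<^sub>R v)) has_vector_derivative f' v) (at s)"
proof -
  obtain \<delta> where \<delta>: "\<delta> > 0" "\<And>t. \<bar>t\<bar> < \<delta> \<Longrightarrow> x + s *\<^sub>R v + t *\<^sub>R v \<in> U"
    using subspace_openin_line assms by metis
  have lin: "linear f'"
    using f by (rule has_derivative_linear)
  have sub: "(\<lambda>t. x + t *\<^sub>R v) ` ball s \<delta> \<subseteq> U"
  proof clarify
    fix t assume "t \<in> ball s \<delta>"
    then show "x + t *\<^sub>R v \<in> U"
      using \<delta>(2)[of "t - s"] by (simp add: algebra_simps dist_norm)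
  qed
  have "(f \<circ> (\<lambda>t. x + t *\<^sub>R v) has_derivative f' \<circ> (\<lambda>t. t *\<^sub>R v)) (at s within ball s \<delta>)"
    by (rule diff_chain_within) (auto intro!: derivative_eq_intros has_derivative_subset[OF f sub])
  then show ?thesis
    using \<open>\<delta> > 0\<close> lin
    by (simp add: has_vector_derivative_def o_def linear_scale at_within_open[of s "ball s \<delta>"])
qed

lemma has_derivative_within_subspace_unique:
  fixes V :: "'a::real_normed_vector set"
  assumes "subspace V" and "openin (top_of_set V) U" and "x \<in> U" "v \<in> V"
    and "(f has_derivative f') (at x within U)" and "(f has_derivative g') (at x within U)"
  shows "f' v = g' v"
  using vector_derivative_unique_at has_vector_derivative_along_line[of V U x 0 v f f']
    has_vector_derivative_along_line[of V U x 0 v f g'] assms by force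

section \<open>Symmetry of second derivatives\<close>

text \<open>The mean value theorem turns the second difference into \<open>t\<close> times a
  difference of values of \<open>f' _ b\<close> at two points that differ by
  \<open>t *\<^sub>R a\<close>. Both points are close to \<open>x\<close>, so the linear
  approximation \<open>H\<close> at \<open>x\<close> turns this into \<open>t\<^sup>2 * H a\<close>
  up to a small multiple of \<open>t\<^sup>2\<close>.\<close>

lemma second_difference_bound:
  fixes V :: "'a::real_normed_vector set" and f :: "'a \<Rightarrow> real"
  assumes V: "subspace V" and U: "openin (top_of_set V) U" and x: "x \<in> U" and ab: "a \<in> V" "b \<in> V"
    and f: "\<And>y. y \<in> U \<Longrightarrow> (f has_derivative f' y) (at y within U)"
    and H: "((\<lambda>y. f' y b) has_derivative H) (at x within U)" and "e > 0"
  obtains \<delta> where "\<delta> > 0"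
    "\<And>t. \<lbrakk>0 < t; t < \<delta>\<rbrakk> \<Longrightarrow>
      \<bar>f (x + t *\<^sub>R a + t *\<^sub>R b) - f (x + t *\<^sub>R a) - f (x + t *\<^sub>R b) + f x - t\<^sup>2 * H a\<bar> \<le> e * t\<^sup>2"
proof -
  define k where "k = 2 * (norm a + norm b) + 1"
  have k: "k > 0"
    by (simp add: k_def add_nonneg_pos)
  have linH: "linear H"
    using H by (rule has_derivative_linear)
  obtain d1 where d1: "d1 > 0"
    "\<And>y. \<lbrakk>y \<in> U; norm (y - x) < d1\<rbrakk> \<Longrightarrow> \<bar>f' y b - f' x b - H (y - x)\<bar> \<le> e / k * norm (y - x)"
    using H \<open>e > 0\<close> k unfolding has_derivative_within_alt by (metis divide_pos_pos real_norm_def)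
  obtain d2 where d2: "d2 > 0" "V \<inter> ball x d2 \<subseteq> U"
    using U x by (metis openin_contains_ball Int_commute)
  define \<delta> where "\<delta> = min d1 d2 / k"
  have Vx: "x \<in> V"
    using U x openin_imp_subset by blast
  have near: "x + s *\<^sub>R a + r *\<^sub>R b \<in> U \<and> norm (s *\<^sub>R a + r *\<^sub>R b) < d1
      \<and> norm (s *\<^sub>R a + r *\<^sub>R b) \<le> t * (norm a + norm b)"
    if "0 \<le> s" "s \<le> t" "0 \<le> r" "r \<le> t" "t < \<delta>" for s r t
  proof -
    have "norm (s *\<^sub>R a + r *\<^sub>R b) \<le> s * norm a + r * norm b"
      using that by (metis norm_triangle_ineq norm_scaleR abs_of_nonneg)
    also have "\<dots> \<le> t * (norm a + norm b)"
      using that by (simp add: distrib_left add_mono mult_right_mono)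
    finally have 1: "norm (s *\<^sub>R a + r *\<^sub>R b) \<le> t * (norm a + norm b)" .
    also have "\<dots> \<le> t * k"
      using that by (intro mult_left_mono) (auto simp: k_def)
    also have "\<dots> < min d1 d2"
      using that(5) k by (simp add: \<delta>_def pos_less_divide_eq)
    finally have 2: "norm (s *\<^sub>R a + r *\<^sub>R b) < min d1 d2" .
    have "x + s *\<^sub>R a + r *\<^sub>R b \<in> V"
      using V Vx ab by (intro subspace_add subspace_scale)
    moreover have "dist x (x + s *\<^sub>R a + r *\<^sub>R b) < d2"
      using 2 by (simp add: dist_commute[of x]) (simp add: dist_norm add.assoc)
    ultimately show ?thesis
      using 1 2 d2(2) by auto
  qed
  show ?thesis
  proof
    show "\<delta> > 0"
      using d1 d2 k by (simp add: \<delta>_def)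
    fix t :: real assume t: "0 < t" "t < \<delta>"
    \<comment> \<open>The second difference is \<open>h t - h 0\<close>, an increment of a function
      of one variable.\<close>
    define h where "h s = f (x + t *\<^sub>R a + s *\<^sub>R b) - f (x + s *\<^sub>R b)" for s
    have "(h has_real_derivative f' (x + t *\<^sub>R a + s *\<^sub>R b) b - f' (x + s *\<^sub>R b) b) (at s)"
      if "0 \<le> s" "s \<le> t" for s
    proof -
      have "x + t *\<^sub>R a + s *\<^sub>R b \<in> U" "x + s *\<^sub>R b \<in> U"
        using near[of t t s] near[of 0 t s] that t by auto
      then show ?thesis
        unfolding h_def has_real_derivative_iff_has_vector_derivative
        using V U ab f by (intro has_vector_derivative_diff has_vector_derivative_along_line[of V U])
    qed
    then obtain s where s: "0 < s" "s < t"
      "h t - h 0 = (t - 0) * (f' (x + t *\<^sub>R a + s *\<^sub>R b) b - f' (x + s *\<^sub>R b) b)"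
      using MVT2[OF t(1), of h "\<lambda>s. f' (x + t *\<^sub>R a + s *\<^sub>R b) b - f' (x + s *\<^sub>R b) b"] by blast
    define y where "y = x + t *\<^sub>R a + s *\<^sub>R b"
    define z where "z = x + s *\<^sub>R b"
    have yz: "y \<in> U" "norm (y - x) < d1" "norm (y - x) \<le> t * (norm a + norm b)"
      "z \<in> U" "norm (z - x) < d1" "norm (z - x) \<le> t * (norm a + norm b)"
      using near[of t t s] near[of 0 t s] s t by (auto simp: y_def z_def add.assoc)
    have Hyz: "H (y - x) - H (z - x) = t * H a"
      using linH by (simp add: y_def z_def linear_add linear_scale add.assoc)
    have "\<bar>f' y b - f' z b - t * H a\<bar> =
        \<bar>(f' y b - f' x b - H (y - x)) - (f' z b - f' x b - H (z - x))\<bar>"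
      using Hyz by (simp add: algebra_simps)
    also have "\<dots> \<le> e / k * norm (y - x) + e / k * norm (z - x)"
      using d1(2)[of y] d1(2)[of z] yz by linarith
    also have "\<dots> \<le> e / k * (t * (norm a + norm b)) + e / k * (t * (norm a + norm b))"
      using yz \<open>e > 0\<close> k by (intro add_mono mult_left_mono) auto
    also have "\<dots> = e / k * t * (2 * (norm a + norm b))"
      by (simp add: algebra_simps)
    also have "\<dots> \<le> e / k * t * k"
      using \<open>e > 0\<close> k t by (intro mult_left_mono) (auto simp: k_def)
    finally have "\<bar>f' y b - f' z b - t * H a\<bar> \<le> e * t"
      using k by simp
    then have "t * \<bar>f' y b - f' z b - t * H a\<bar> \<le> t * (e * t)"
      using t by (intro mult_left_mono) auto
    moreover have "t * \<bar>f' y b - f' z b - t * H a\<bar> = \<bar>h t - h 0 - t\<^sup>2 * H a\<bar>"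
      using s(3) t by (simp add: y_def z_def abs_mult_pos' power2_eq_square algebra_simps)
    ultimately show "\<bar>f (x + t *\<^sub>R a + t *\<^sub>R b) - f (x + t *\<^sub>R a) - f (x + t *\<^sub>R b) + f x - t\<^sup>2 * H a\<bar>
        \<le> e * t\<^sup>2"
      by (simp add: h_def power2_eq_square algebra_simps)
  qed
qed

text \<open>The second difference is symmetric in \<open>a\<close> and \<open>b\<close>. By the
  preceding bound, \<open>t\<^sup>2 * Hb a\<close> and \<open>t\<^sup>2 * Ha b\<close> both
  approximate it up to an arbitrarily small multiple of \<open>t\<^sup>2\<close>.\<close>

lemma second_derivative_symmetric:
  fixes V :: "'a::real_normed_vector set" and f :: "'a \<Rightarrow> real"
  assumes VU: "subspace V" "openin (top_of_set V) U" "x \<in> U" and ab: "a \<in> V" "b \<in> V"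
    and f: "\<And>y. y \<in> U \<Longrightarrow> (f has_derivative f' y) (at y within U)"
    and Ha: "((\<lambda>y. f' y a) has_derivative Ha) (at x within U)"
    and Hb: "((\<lambda>y. f' y b) has_derivative Hb) (at x within U)"
  shows "Hb a = Ha b"
proof -
  \<comment> \<open>The summand 0 gives the claim the shape that \<open>field_le_epsilon\<close>
    expects.\<close>
  have "\<bar>Hb a - Ha b\<bar> \<le> 0 + e" if "e > 0" for e
  proof -
    have e: "e / 2 > 0"
      using that by simp
    obtain d1 where d1: "d1 > 0" "\<And>t. \<lbrakk>0 < t; t < d1\<rbrakk> \<Longrightarrow>
      \<bar>f (x + t *\<^sub>R a + t *\<^sub>R b) - f (x + t *\<^sub>R a) - f (x + t *\<^sub>R b) + f x - t\<^sup>2 * Hb a\<bar> \<le> e / 2 * t\<^sup>2"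
      using second_difference_bound[OF VU ab f Hb e] by blast
    obtain d2 where d2: "d2 > 0" "\<And>t. \<lbrakk>0 < t; t < d2\<rbrakk> \<Longrightarrow>
      \<bar>f (x + t *\<^sub>R b + t *\<^sub>R a) - f (x + t *\<^sub>R b) - f (x + t *\<^sub>R a) + f x - t\<^sup>2 * Ha b\<bar> \<le> e / 2 * t\<^sup>2"
      using second_difference_bound[OF VU ab(2,1) f Ha e] by blast
    define t where "t = min d1 d2 / 2"
    have t: "0 < t" "t < d1" "t < d2"
      using d1 d2 by (auto simp: t_def)
    define P where "P = f (x + t *\<^sub>R a + t *\<^sub>R b) - f (x + t *\<^sub>R a) - f (x + t *\<^sub>R b) + f x"
    have "\<bar>P - t\<^sup>2 * Hb a\<bar> \<le> e / 2 * t\<^sup>2"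
      using d1(2)[OF t(1,2)] by (simp add: P_def)
    moreover have "\<bar>P - t\<^sup>2 * Ha b\<bar> \<le> e / 2 * t\<^sup>2"
      using d2(2)[OF t(1,3)] by (simp add: P_def algebra_simps)
    ultimately have "\<bar>t\<^sup>2 * Hb a - t\<^sup>2 * Ha b\<bar> \<le> e * t\<^sup>2"
      by linarith
    then have "t\<^sup>2 * \<bar>Hb a - Ha b\<bar> \<le> t\<^sup>2 * e"
      by (simp add: abs_mult mult.commute[of e] flip: right_diff_distrib)
    then show ?thesis
      using t by simp
  qed
  then have "\<bar>Hb a - Ha b\<bar> \<le> 0"
    by (rule field_le_epsilon)
  then show ?thesis
    by simp
qed

section \<open>Immersions\<close>

lemma inj_on_subspace_bounded_below:
  fixes f :: "'a::euclidean_space \<Rightarrow> 'b::euclidean_space"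
  assumes "subspace V" "linear f" "inj_on f V"
  obtains c where "c > 0" "\<And>v. v \<in> V \<Longrightarrow> c * norm v \<le> norm (f v)"
proof -
  have "\<forall>v\<in>V. f v = 0 \<longrightarrow> v = 0"
    using assms by (simp add: linear_inj_on_iff_eq_0)
  then show ?thesis
    using injective_imp_isometric[of V f] assms that
    by (auto simp: closed_subspace linear_conv_bounded_linear)
qed

lemma has_vector_derivative_quotient:
  assumes "(c has_vector_derivative X) (at 0)"
  shows "((\<lambda>t. (c t - c 0) /\<^sub>R t) \<longlongrightarrow> X) (at (0::real))"
proof -
  have lim: "((\<lambda>t. norm (c t - c 0 - t *\<^sub>R X) / \<bar>t\<bar>) \<longlongrightarrow> 0) (at 0)"
    using assms by (simp add: has_vector_derivative_def has_derivative_at)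
  have eq: "norm (c t - c 0 - t *\<^sub>R X) / \<bar>t\<bar> = norm ((c t - c 0) /\<^sub>R t - X)" if "t \<noteq> 0" for t
  proof -
    have "(c t - c 0) /\<^sub>R t - X = (c t - c 0 - t *\<^sub>R X) /\<^sub>R t"
      using that by (simp add: scaleR_diff_right)
    then show ?thesis
      by (simp add: divide_inverse_commute)
  qed
  have "((\<lambda>t. norm ((c t - c 0) /\<^sub>R t - X)) \<longlongrightarrow> 0) (at 0)"
    by (rule Lim_transform_eventually[OF lim]) (simp add: eventually_at_filter eq)
  then show ?thesis
    by (rule LIM_zero_cancel[OF tendsto_norm_zero_cancel])
qed

text \<open>The lift \<open>y\<close> is only known to converge. As \<open>F'\<close> is bounded
  below on \<open>V\<close>, the difference quotients of \<open>y\<close> are bounded, so those of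
  \<open>c\<close> differ from their linear approximations in \<open>F'\<close>
  V\<open>by a null function. Hence\<close>X\<open>is a limit of points of\<close>F'
  \<open>V\<close>, which is closed as a finite-dimensional subspace.\<close>

lemma velocity_in_range:
  fixes F :: "'a::euclidean_space \<Rightarrow> 'b::euclidean_space"
  assumes V: "subspace V" and UV: "U \<subseteq> V" and y0: "y0 \<in> U"
    and F: "(F has_derivative F') (at y0 within U)" and inj: "inj_on F' V"
    and yU: "\<forall>\<^sub>F t in at (0::real). y t \<in> U" and y: "(y \<longlongrightarrow> y0) (at 0)"
    and c: "(c has_vector_derivative X) (at 0)" and c0: "c 0 = F y0"
    and cy: "\<forall>\<^sub>F t in at 0. c t = F (y t)"
  shows "X \<in> F' ` V"
proof -
  have linF: "linear F'"
    using F by (rule has_derivative_linear)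
  obtain k where k: "k > 0" "\<And>v. v \<in> V \<Longrightarrow> k * norm v \<le> norm (F' v)"
    using inj_on_subspace_bounded_below[OF V linF inj] by blast
  have "((\<lambda>t. (c t - c 0) /\<^sub>R t) \<longlongrightarrow> X) (at 0)"
    by (rule has_vector_derivative_quotient[OF c])
  then have q: "((\<lambda>t. (F (y t) - F y0) /\<^sub>R t) \<longlongrightarrow> X) (at 0)"
    by (rule Lim_transform_eventually) (use cy c0 in \<open>auto elim: eventually_mono\<close>)
  define B where "B = norm X + 1"
  have B: "B > 0"
    by (simp add: B_def add_nonneg_pos)
  have evB: "\<forall>\<^sub>F t in at 0. norm ((F (y t) - F y0) /\<^sub>R t) < B"
    using order_tendstoD(2)[OF tendsto_norm[OF q], of B] by (simp add: B_def)
  have lin_approx: "\<forall>\<^sub>F t in at 0. norm (F (y t) - F y0 - F' (y t - y0)) \<le> e * norm (y t - y0)"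
    if e: "e > 0" for e
  proof -
    obtain d where d: "d > 0" "\<And>z. \<lbrakk>z \<in> U; norm (z - y0) < d\<rbrakk> \<Longrightarrow>
        norm (F z - F y0 - F' (z - y0)) \<le> e * norm (z - y0)"
      using iffD1[OF has_derivative_within_alt F, THEN conjunct2, rule_format, OF e] by blast
    have "\<forall>\<^sub>F t in at 0. dist (y t) y0 < d"
      using y d(1) by (rule tendstoD)
    with yU show ?thesis
      by eventually_elim (use d(2) in \<open>simp add: dist_norm\<close>)
  qed
  have yV: "\<forall>\<^sub>F t in at 0. y t - y0 \<in> V"
    using yU by eventually_elim (use UV y0 V subspace_diff in blast)
  have nz: "\<forall>\<^sub>F t in at (0::real). t \<noteq> 0"
    by (simp add: eventually_at_filter)
  \<comment> \<open>With precision \<open>k / 2\<close>, half of the lower bound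
    \<open>k * norm (y t - y0)\<close> absorbs the error of the linear approximation; the other half
    is controlled by the increment of \<open>F\<close>, which is at most
    \<open>B * \<bar>t\<bar>\<close>.\<close>
  have slow: "\<forall>\<^sub>F t in at 0. norm (y t - y0) \<le> 2 * B / k * \<bar>t\<bar>"
    using lin_approx[OF half_gt_zero[OF k(1)]] evB yV nz
  proof eventually_elim
    case (elim t)
    have "k * norm (y t - y0) \<le> norm (F' (y t - y0))"
      using k elim by blast
    also have "\<dots> \<le> norm (F (y t) - F y0) + norm (F (y t) - F y0 - F' (y t - y0))"
      by (metis norm_triangle_sub norm_minus_commute add.commute)
    finally have "k * norm (y t - y0) \<le> 2 * norm (F (y t) - F y0)"
      using elim k by (auto simp: field_simps)
    also have "\<dots> \<le> 2 * (B * \<bar>t\<bar>)"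
      using elim by (simp add: divide_simps)
    finally show ?case
      using k(1) by (simp add: field_simps)
  qed
  have lim0: "((\<lambda>t. (F (y t) - F y0) /\<^sub>R t - F' ((y t - y0) /\<^sub>R t)) \<longlongrightarrow> 0) (at 0)"
  proof (rule tendstoI)
    fix e :: real assume e: "e > 0"
    \<comment> \<open>Together with the bound \<open>slow\<close> this makes the error at most half
      of \<open>e * \<bar>t\<bar>\<close>, which gives the strict inequality.\<close>
    define e' where "e' = e / (4 * B / k)"
    have e': "e' > 0"
      using e k B by (simp add: e'_def)
    show "\<forall>\<^sub>F t in at 0. dist ((F (y t) - F y0) /\<^sub>R t - F' ((y t - y0) /\<^sub>R t)) 0 < e"
      using lin_approx[OF e'] slow nz
    proof eventually_elim
      case (elim t)
      have eq: "(F (y t) - F y0) /\<^sub>R t - F' ((y t - y0) /\<^sub>R t) =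
          (F (y t) - F y0 - F' (y t - y0)) /\<^sub>R t"
        using linF by (simp add: linear_scale flip: scaleR_diff_right)
      have "norm (F (y t) - F y0 - F' (y t - y0)) \<le> e' * (2 * B / k * \<bar>t\<bar>)"
        using elim(1,2) e' by (meson mult_left_mono order_trans less_imp_le)
      also have "\<dots> < e * \<bar>t\<bar>"
        using elim(3) e k(1) B by (simp add: e'_def)
      finally show ?case
        using elim(3) unfolding dist_norm eq
        by (simp add: pos_divide_less_eq flip: divide_inverse_commute)
    qed
  qed
  have "((\<lambda>t. F' ((y t - y0) /\<^sub>R t)) \<longlongrightarrow> X) (at 0)"
    using tendsto_diff[OF q lim0] by simp
  moreover have "\<forall>\<^sub>F t in at 0. F' ((y t - y0) /\<^sub>R t) \<in> F' ` V"
    using yV by eventually_elim (use V subspace_scale in blast)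
  moreover have "closed (F' ` V)"
    using V linF by (intro closed_subspace linear_subspace_image)
  ultimately show ?thesis
    using Lim_in_closed_set[of "F' ` V"] by (metis trivial_limit_at)
qed

text \<open>Where \<open>F'\<close> is within \<open>k / 2\<close> of \<open>F' y0\<close>, the mean
  value inequality bounds the deviation of \<open>F\<close> from its linear part at
  \<open>y0\<close> by \<open>k / 2 * norm (a - b)\<close>. The linear part expands by at least
  \<open>k\<close>, so \<open>k / 2\<close> is left. Thus \<open>F\<close> has a Lipschitz inverse
  on a small closed ball of \<open>V\<close>.\<close>

lemma C1_immersion_locally_bounded_below:
  fixes F :: "'a::euclidean_space \<Rightarrow> 'b::euclidean_space" and F' :: "'a \<Rightarrow> 'a \<Rightarrow>\<^sub>L 'b"
  assumes V: "subspace V" and U: "openin (top_of_set V) U" and y0: "y0 \<in> U"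
    and F: "\<And>y. y \<in> U \<Longrightarrow> (F has_derivative F' y) (at y within U)"
    and cont: "continuous_on U F'" and inj: "inj_on (F' y0) V"
  obtains r k where "r > 0" "k > 0" "V \<inter> cball y0 r \<subseteq> U"
    "\<And>a b. \<lbrakk>a \<in> V \<inter> cball y0 r; b \<in> V \<inter> cball y0 r\<rbrakk> \<Longrightarrow> k * norm (a - b) \<le> norm (F a - F b)"
proof -
  obtain k where k: "k > 0" "\<And>v. v \<in> V \<Longrightarrow> k * norm v \<le> norm (F' y0 v)"
    using inj_on_subspace_bounded_below[OF V bounded_linear.linear[OF blinfun.bounded_linear_right] inj] by blast
  obtain d1 where d1: "d1 > 0" "\<And>y. \<lbrakk>y \<in> U; dist y y0 < d1\<rbrakk> \<Longrightarrow> dist (F' y) (F' y0) < k / 2"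
    using cont y0 k(1) unfolding continuous_on_iff by (metis half_gt_zero)
  obtain d2 where d2: "d2 > 0" "V \<inter> ball y0 d2 \<subseteq> U"
    using U y0 by (metis openin_contains_ball Int_commute)
  define r where "r = min d1 d2 / 2"
  have r: "r > 0" "r < d1" "r < d2"
    using d1 d2 by (auto simp: r_def)
  \<comment> \<open>A ball is chosen because the mean value inequality needs the segment from
    \<open>b\<close> to \<open>a\<close>.\<close>
  define K where "K = V \<inter> cball y0 r"
  have KU: "K \<subseteq> U"
    using d2(2) r by (auto simp: K_def)
  have y0K: "y0 \<in> K"
    using y0 U r openin_imp_subset by (fastforce simp: K_def)
  have conv: "convex K"
    using V by (auto simp: K_def intro: convex_Int subspace_imp_convex)
  have "k / 2 * norm (a - b) \<le> norm (F a - F b)" if ab: "a \<in> K" "b \<in> K" for a b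
  proof -
    have "norm (F a - F b - F' y0 (a - b)) \<le> norm (a - b) * (k / 2)"
    proof (rule differentiable_bound_linearization[where S = K and f' = "\<lambda>y. blinfun_apply (F' y)"])
      show "b + t *\<^sub>R (a - b) \<in> K" if "t \<in> {0..1}" for t
        using convexD_alt[OF conv ab(2,1), of t] that by (simp add: algebra_simps)
      show "(F has_derivative F' y) (at y within K)" if "y \<in> K" for y
        using F KU that has_derivative_subset by blast
      show "onorm (blinfun_apply (F' y) - blinfun_apply (F' y0)) \<le> k / 2" if "y \<in> K" for y
      proof -
        have "dist (F' y) (F' y0) < k / 2"
          using that KU r by (intro d1) (auto simp: K_def dist_commute)
        then show ?thesis
          by (simp add: dist_norm norm_blinfun.rep_eq minus_blinfun.rep_eq fun_diff_def)
      qed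
    qed (use y0K in simp)
    moreover have "k * norm (a - b) \<le> norm (F' y0 (a - b))"
      using ab V by (intro k subspace_diff) (auto simp: K_def)
    moreover have "norm (F' y0 (a - b)) \<le> norm (F a - F b) + norm (F a - F b - F' y0 (a - b))"
      by (metis norm_triangle_sub norm_minus_commute add.commute)
    ultimately show ?thesis
      by (simp add: algebra_simps)
  qed
  then show ?thesis
    using that[of r "k / 2"] r(1) k(1) KU by (simp add: K_def)
qed

section \<open>Isotropy of the lines normal to a parametrized submanifold\<close>

text \<open>On \<open>V\<close>, the derivatives \<open>m y\<close> of \<open>n\<close> and
  \<open>s y\<close> of \<open>\<sigma>\<close> take values orthogonal to \<open>n y\<close>. If the
  derivative of the normal line kills \<open>a\<close>, its first component gives
  \<open>m y a = 0\<close>, and then its second gives \<open>s y a = 0\<close>. In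
  \<open>\<Omega>\<close> the terms along \<open>n y\<close> drop out and those with
  \<open>m y a \<bullet> m y b\<close> cancel. What remains is
  \<open>m y a \<bullet> s y b - m y b \<bullet> s y a\<close>, zero by the symmetry of the second
  fundamental form.\<close>

lemma normal_lines_parametrized:
  fixes \<sigma> n :: "'k::euclidean_space \<Rightarrow> 'a::euclidean_space"
  assumes V: "subspace V" and U: "openin (top_of_set V) U"
    and \<sigma>: "C2_on U \<sigma>" and n: "C2_on U n"
    and unit: "\<And>y. y \<in> U \<Longrightarrow> norm (n y) = 1"
    and normal: "\<And>y f' a. \<lbrakk>y \<in> U; a \<in> V; (\<sigma> has_derivative f') (at y within U)\<rbrakk> \<Longrightarrow> n y \<bullet> f' a = 0"
    and immersion: "\<And>y. y \<in> U \<Longrightarrow> \<exists>f'. (\<sigma> has_derivative f') (at y within U) \<and> inj_on f' V"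
  obtains F' :: "'k \<Rightarrow> 'k \<Rightarrow>\<^sub>L ('a \<times> 'a)" where
    "continuous_on U F'"
    "\<And>y. y \<in> U \<Longrightarrow>
      ((\<lambda>y. (n y, \<sigma> y - (n y \<bullet> \<sigma> y) *\<^sub>R n y)) has_derivative F' y) (at y within U)"
    "\<And>y. y \<in> U \<Longrightarrow> inj_on (F' y) V"
    "\<And>p y a b. \<lbrakk>y \<in> U; a \<in> V; b \<in> V\<rbrakk> \<Longrightarrow> \<Omega> p (F' y a) (F' y b) = 0"
proof -
  obtain s s2 where s: "\<And>y. y \<in> U \<Longrightarrow> (\<sigma> has_derivative blinfun_apply (s y)) (at y within U)"
    and s2: "\<And>y. y \<in> U \<Longrightarrow> (s has_derivative blinfun_apply (s2 y)) (at y within U)"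
    using \<sigma> unfolding C2_on_def by blast
  obtain m m2 where m: "\<And>y. y \<in> U \<Longrightarrow> (n has_derivative blinfun_apply (m y)) (at y within U)"
    and m2: "\<And>y. y \<in> U \<Longrightarrow> (m has_derivative blinfun_apply (m2 y)) (at y within U)"
    using n unfolding C2_on_def by blast
  define L where "L y h =
    (m y h, s y h - ((n y \<bullet> \<sigma> y) *\<^sub>R m y h + (n y \<bullet> s y h + m y h \<bullet> \<sigma> y) *\<^sub>R n y))" for y h
  define F' where "F' y = Blinfun (L y)" for y
  have L: "((\<lambda>y. (n y, \<sigma> y - (n y \<bullet> \<sigma> y) *\<^sub>R n y)) has_derivative L y) (at y within U)"
    if "y \<in> U" for y
    unfolding L_def
    by (intro has_derivative_Pair has_derivative_diff has_derivative_scaleR has_derivative_inner m s that)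
  have F'_L: "blinfun_apply (F' y) = L y" if "y \<in> U" for y
    using has_derivative_bounded_linear[OF L[OF that]] by (simp add: F'_def bounded_linear_Blinfun_apply)
  have zero_deriv: "g' a = 0"
    if "y \<in> U" "a \<in> V" "(g has_derivative g') (at y within U)" "\<And>y. y \<in> U \<Longrightarrow> g y = c"
    for g :: "'k \<Rightarrow> real" and y a g' c
  proof -
    have "(g has_derivative (\<lambda>h. 0)) (at y within U)"
      by (rule has_derivative_transform[OF that(1,4) has_derivative_const])
    then show ?thesis
      using has_derivative_within_subspace_unique[OF V U that(1-3)] by blast
  qed
  have m_normal: "n y \<bullet> m y a = 0" if "y \<in> U" "a \<in> V" for y a
  proof -
    have "((\<lambda>y. n y \<bullet> n y) has_derivative (\<lambda>h. n y \<bullet> m y h + m y h \<bullet> n y)) (at y within U)"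
      by (intro has_derivative_inner m that)
    moreover have "n y \<bullet> n y = 1" if "y \<in> U" for y
      using unit that by (simp add: norm_eq_1)
    ultimately have "n y \<bullet> m y a + m y a \<bullet> n y = 0"
      using zero_deriv that by blast
    then show ?thesis
      by (simp add: inner_commute)
  qed
  have s_normal: "n y \<bullet> s y a = 0" if "y \<in> U" "a \<in> V" for y a
    using normal s that by blast
  have s2_apply: "((\<lambda>z. w \<bullet> s z b) has_derivative (\<lambda>h. w \<bullet> s2 y h b)) (at y within U)"
    if "y \<in> U" for w y b
    using s2[OF that] by (auto intro!: derivative_eq_intros)
  \<comment> \<open>Differentiating \<open>n z \<bullet> s z b = 0\<close> in direction
    \<open>a\<close> expresses the second fundamental form by second derivatives of
    \<open>\<sigma>\<close>.\<close>
  have second_form: "m y a \<bullet> s y b = - (n y \<bullet> s2 y a b)" if "y \<in> U" "a \<in> V" "b \<in> V" for y a b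
  proof -
    have "((\<lambda>z. s z b) has_derivative (\<lambda>h. s2 y h b)) (at y within U)"
      using s2[OF that(1)] by (auto intro!: derivative_eq_intros)
    then have "((\<lambda>z. n z \<bullet> s z b) has_derivative (\<lambda>h. n y \<bullet> s2 y h b + m y h \<bullet> s y b)) (at y within U)"
      by (intro has_derivative_inner m that)
    then have "n y \<bullet> s2 y a b + m y a \<bullet> s y b = 0"
      using zero_deriv s_normal that by blast
    then show ?thesis
      by simp
  qed
  have symmetric: "m y a \<bullet> s y b = m y b \<bullet> s y a" if "y \<in> U" "a \<in> V" "b \<in> V" for y a b
  proof -
    \<comment> \<open>The normal is frozen at \<open>y\<close>. This leaves a real function of
      \<open>z\<close>, to which the symmetry of second derivatives applies.\<close>
    have "((\<lambda>z. n y \<bullet> \<sigma> z) has_derivative (\<lambda>h. n y \<bullet> s z h)) (at z within U)" if "z \<in> U" for z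
      by (intro has_derivative_inner_right s that)
    then have "n y \<bullet> s2 y a b = n y \<bullet> s2 y b a"
      using that by (intro second_derivative_symmetric[OF V U that, where f' = "\<lambda>z h. n y \<bullet> s z h"] s2_apply)
    then show ?thesis
      using second_form that by simp
  qed
  show ?thesis
  proof
    show "continuous_on U F'"
    proof (rule continuous_on_blinfun_componentwise)
      fix i :: 'k assume "i \<in> Basis"
      have "continuous_on U n" "continuous_on U \<sigma>" "continuous_on U m" "continuous_on U s"
        by (rule has_derivative_continuous_on, erule m s m2 s2)+
      then have "continuous_on U (\<lambda>y. L y i)"
        unfolding L_def by (intro continuous_intros)
      then show "continuous_on U (\<lambda>y. F' y i)"
        by (simp add: F'_L cong: continuous_on_cong)
    qed
    show "((\<lambda>y. (n y, \<sigma> y - (n y \<bullet> \<sigma> y) *\<^sub>R n y)) has_derivative F' y) (at y within U)"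
      if "y \<in> U" for y
      using L F'_L that by simp
    show "inj_on (F' y) V" if y: "y \<in> U" for y
    proof -
      obtain f' where f': "(\<sigma> has_derivative f') (at y within U)" "inj_on f' V"
        using immersion y by blast
      have "a = 0" if a: "a \<in> V" "F' y a = 0" for a
      proof -
        have "m y a = 0"
          using a y by (simp add: F'_L L_def zero_prod_def)
        then have "s y a = 0"
          using a y s_normal by (simp add: F'_L L_def zero_prod_def)
        moreover have "f' a = s y a"
          using has_derivative_within_subspace_unique[OF V U y a(1) f'(1) s[OF y]] .
        ultimately show ?thesis
          using f' a V by (metis linear_inj_on_iff_eq_0 has_derivative_linear)
      qed
      then show ?thesis
        using V by (simp add: linear_inj_on_iff_eq_0 bounded_linear.linear blinfun.bounded_linear_right)
    qed
    show "\<Omega> p (F' y a) (F' y b) = 0" if "y \<in> U" "a \<in> V" "b \<in> V" for p y a b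
      using that symmetric[OF that] m_normal[OF that(1)] s_normal[OF that(1)]
      by (simp add: F'_L L_def \<Omega>_eq inner_diff_right inner_add_right inner_commute)
  qed
qed

section \<open>Velocities of curves in the image of an immersion\<close>

text \<open>
  Isotropy in terms of velocities of curves makes sense for arbitrary sets, in particular for pieces
  of \<open>points \<Gamma>\<close>, whatever the topology of \<open>\<Gamma>\<close> is.
\<close>

definition isotropic_along_curves :: "('a::euclidean_space \<times> 'a) set \<Rightarrow> bool" where
  "isotropic_along_curves C \<longleftrightarrow>
    (\<forall>c d X Y. c 0 = d 0 \<longrightarrow>
      (c has_vector_derivative X) (at (0::real)) \<longrightarrow> (d has_vector_derivative Y) (at (0::real)) \<longrightarrow>
      (\<forall>\<^sub>F t in at 0. c t \<in> C) \<longrightarrow> (\<forall>\<^sub>F t in at 0. d t \<in> C) \<longrightarrow> \<Omega> (c 0) X Y = 0)"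

lemma isotropic_along_curvesD:
  assumes "isotropic_along_curves C" "c 0 = d 0"
    and "(c has_vector_derivative X) (at (0::real))" "(d has_vector_derivative Y) (at (0::real))"
    and "\<forall>\<^sub>F t in at 0. c t \<in> C" "\<forall>\<^sub>F t in at 0. d t \<in> C"
  shows "\<Omega> (c 0) X Y = 0"
  using assms unfolding isotropic_along_curves_def by blast

text \<open>On a small compact ball \<open>F\<close> has a Lipschitz inverse, so curves in the image
  lift continuously at time 0 and their velocities lie in the range of the derivative of
  \<open>F\<close>. Two curves through the same point have the same lifted base point by
  injectivity, and on the range of that one derivative \<open>\<Omega>\<close> vanishes.\<close>

lemma isotropic_immersion_local_image:
  fixes F :: "'k::euclidean_space \<Rightarrow> 'a::euclidean_space \<times> 'a" and F' :: "'k \<Rightarrow> 'k \<Rightarrow>\<^sub>L ('a \<times> 'a)"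
  assumes V: "subspace V" and U: "openin (top_of_set V) U" and y0: "y0 \<in> U"
    and F: "\<And>y. y \<in> U \<Longrightarrow> (F has_derivative F' y) (at y within U)"
    and cont: "continuous_on U F'" and inj: "\<And>y. y \<in> U \<Longrightarrow> inj_on (F' y) V"
    and iso: "\<And>p y a b. \<lbrakk>y \<in> U; a \<in> V; b \<in> V\<rbrakk> \<Longrightarrow> \<Omega> p (F' y a) (F' y b) = 0"
  obtains r where "r > 0" "V \<inter> cball y0 r \<subseteq> U" "compact (F ` (V \<inter> cball y0 r))"
    "isotropic_along_curves (F ` (V \<inter> cball y0 r))"
proof -
  obtain r k where r: "r > 0" "k > 0" "V \<inter> cball y0 r \<subseteq> U" and
    bdd: "\<And>a b. \<lbrakk>a \<in> V \<inter> cball y0 r; b \<in> V \<inter> cball y0 r\<rbrakk> \<Longrightarrow> k * norm (a - b) \<le> norm (F a - F b)"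
    using C1_immersion_locally_bounded_below[OF V U y0 F cont inj[OF y0]] by blast
  define K where "K = V \<inter> cball y0 r"
  have "continuous_on U F"
    using F by (rule has_derivative_continuous_on)
  then have "continuous_on K F"
    using r(3) continuous_on_subset by (auto simp: K_def)
  moreover have "compact K"
    using V by (simp add: K_def closed_subspace closed_Int_compact)
  ultimately have compact: "compact (F ` K)"
    by (rule compact_continuous_image)
  have velocity: "\<exists>y\<in>K. c 0 = F y \<and> X \<in> F' y ` V"
    if c: "(c has_vector_derivative X) (at 0)" and cC: "\<forall>\<^sub>F t in at 0. c t \<in> F ` K" for c X
  proof -
    have c0: "(c \<longlongrightarrow> c 0) (at 0)"
      using has_vector_derivative_continuous[OF c] by (simp add: continuous_at)
    \<comment> \<open>The filter \<open>at 0\<close> ignores time 0 itself; that \<open>c 0\<close>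
      lies in the image follows from the image being closed.\<close>
    then have "c 0 \<in> F ` K"
      using Lim_in_closed_set[OF compact_imp_closed[OF compact] cC] by simp
    then obtain z where z: "z \<in> K" "c 0 = F z"
      by blast
    have "\<forall>t. \<exists>y. c t \<in> F ` K \<longrightarrow> y \<in> K \<and> c t = F y"
      by blast
    then obtain y where y: "\<And>t. c t \<in> F ` K \<Longrightarrow> y t \<in> K \<and> c t = F (y t)"
      by metis
    have yK: "\<forall>\<^sub>F t in at 0. y t \<in> K \<and> c t = F (y t)"
      using cC by eventually_elim (use y in blast)
    \<comment> \<open>The lift \<open>y\<close> was chosen pointwise. Its convergence comes from the
      lower bound \<open>bdd\<close>, that is, from the Lipschitz inverse.\<close>
    have "(y \<longlongrightarrow> z) (at 0)"
    proof (rule tendstoI)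
      fix e :: real assume "e > 0"
      then have "\<forall>\<^sub>F t in at 0. dist (c t) (c 0) < k * e"
        using tendstoD[OF c0] r(2) by simp
      with yK show "\<forall>\<^sub>F t in at 0. dist (y t) z < e"
      proof eventually_elim
        case (elim t)
        then have "k * norm (y t - z) < k * e"
          using bdd[of "y t" z] z by (auto simp: K_def dist_norm)
        then show ?case
          using r(2) by (simp add: dist_norm)
      qed
    qed
    moreover have "\<forall>\<^sub>F t in at 0. y t \<in> U" "\<forall>\<^sub>F t in at 0. c t = F (y t)"
      using yK r(3) by (auto simp: K_def elim!: eventually_mono)
    moreover have "z \<in> U" "U \<subseteq> V"
      using z r(3) openin_imp_subset[OF U] by (auto simp: K_def)
    ultimately have "X \<in> F' z ` V"
      using velocity_in_range[OF V _ _ F inj _ _ c] z by blast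
    then show ?thesis
      using z by blast
  qed
  have inj_K: "y = z" if "y \<in> K" "z \<in> K" "F y = F z" for y z
    using bdd[of y z] that r(2) by (simp add: K_def mult_le_0_iff)
  have "isotropic_along_curves (F ` K)"
    unfolding isotropic_along_curves_def
  proof (intro allI impI)
    fix c d :: "real \<Rightarrow> 'a \<times> 'a" and X Y
    assume eq: "c 0 = d 0"
      and "(c has_vector_derivative X) (at 0)" "(d has_vector_derivative Y) (at 0)"
      and "\<forall>\<^sub>F t in at 0. c t \<in> F ` K" "\<forall>\<^sub>F t in at 0. d t \<in> F ` K"
    then obtain y z where yz: "y \<in> K" "c 0 = F y" "X \<in> F' y ` V" "z \<in> K" "d 0 = F z" "Y \<in> F' z ` V"
      using velocity by meson
    then have "z = y"
      using eq inj_K by simp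
    moreover have "y \<in> U"
      using yz(1) r(3) by (auto simp: K_def)
    ultimately show "\<Omega> (c 0) X Y = 0"
      using iso yz(3,6) by blast
  qed
  then show ?thesis
    using that r compact by (simp add: K_def)
qed

section \<open>Charts and tangent spaces\<close>

lemma C2_on_imp_C1:
  assumes "C2_on U f"
  obtains f' where "\<And>x. x \<in> U \<Longrightarrow> (f has_derivative blinfun_apply (f' x)) (at x within U)"
    and "continuous_on U f'"
proof -
  obtain f' f'' where *: "\<And>x. x \<in> U \<Longrightarrow> (f has_derivative blinfun_apply (f' x)) (at x within U)"
    "\<And>x. x \<in> U \<Longrightarrow> (f' has_derivative blinfun_apply (f'' x)) (at x within U)"
    using assms unfolding C2_on_def by blast
  show ?thesis
    by (rule that[OF *(1) has_derivative_continuous_on[OF *(2)]])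
qed

lemma C2_on_imp_continuous_on: "C2_on U f \<Longrightarrow> continuous_on U f"
  by (elim C2_on_imp_C1 has_derivative_continuous_on)

lemma C2_manifold_chart_at:
  assumes "C2_manifold N" "p \<in> points N"
  obtains D \<phi> where "(D, \<phi>) \<in> atlas N" "p \<in> D"
proof -
  have "(\<Union>(D, \<phi>)\<in>atlas N. D) = points N"
    using assms(1) unfolding C2_manifold_def by (elim conjE)
  then have "p \<in> (\<Union>(D, \<phi>)\<in>atlas N. D)"
    using assms(2) by simp
  then show ?thesis
    using that by auto
qed

context
  fixes N :: "('p, 'm::euclidean_space) manifold" and D \<phi>
  assumes N: "C2_manifold N" and chart: "(D, \<phi>) \<in> atlas N"
begin

lemma chart_domain_openin: "openin (topology_of N) D"
  using N chart unfolding C2_manifold_def by blast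

lemma chart_homeomorphic: "homeomorphic_map (subtopology (topology_of N) D) (top_of_set (\<phi> ` D)) \<phi>"
  using N chart unfolding C2_manifold_def by blast

lemma chart_range_openin: "openin (top_of_set (model N)) (\<phi> ` D)"
  using N chart unfolding C2_manifold_def by blast

lemma chart_inj_on: "inj_on \<phi> D"
  using homeomorphic_imp_injective_map[OF chart_homeomorphic] openin_subset[OF chart_domain_openin]
  by (simp add: Int_absorb1)

lemma chart_image_openin:
  assumes "openin (topology_of N) E" "E \<subseteq> D"
  shows "openin (top_of_set (model N)) (\<phi> ` E)"
proof -
  have "openin (subtopology (topology_of N) D) E"
    using assms by (auto simp: openin_subtopology)
  then have "openin (top_of_set (\<phi> ` D)) (\<phi> ` E)"
    using chart_homeomorphic by (meson homeomorphic_imp_open_map open_map_def)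
  then show ?thesis
    using chart_range_openin openin_trans by blast
qed

lemma chart_preimage_openin:
  assumes "openin (top_of_set (model N)) W"
  shows "openin (topology_of N) {q \<in> D. \<phi> q \<in> W}"
proof -
  have "openin (top_of_set (\<phi> ` D)) (\<phi> ` D \<inter> W)"
    using assms chart_range_openin openin_imp_subset
    by (metis inf_commute inf_le1 openin_subset_trans openin_Int)
  then have "openin (subtopology (topology_of N) D)
      {q \<in> topspace (subtopology (topology_of N) D). \<phi> q \<in> \<phi> ` D \<inter> W}"
    using chart_homeomorphic openin_continuous_map_preimage homeomorphic_imp_continuous_map by blast
  moreover have "{q \<in> topspace (subtopology (topology_of N) D). \<phi> q \<in> \<phi> ` D \<inter> W} = {q \<in> D. \<phi> q \<in> W}"
    using chart_domain_openin openin_subset by fastforce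
  ultimately show ?thesis
    using chart_domain_openin openin_trans_full by metis
qed

end

section \<open>Tangent spaces computed in a single chart\<close>

lemma immersed_submanifoldD:
  assumes "immersed_submanifold N M"
  shows "C2_manifold N" "points N \<subseteq> M" "subspace (model N)"
    "(D, \<phi>) \<in> atlas N \<Longrightarrow> C2_on (\<phi> ` D) (inv_into D \<phi>)"
    "\<lbrakk>(D, \<phi>) \<in> atlas N; x \<in> \<phi> ` D\<rbrakk> \<Longrightarrow>
      \<exists>f'. (inv_into D \<phi> has_derivative f') (at x within \<phi> ` D) \<and> inj_on f' (model N)"
  using assms
  by (fastforce simp: immersed_submanifold_def C2_manifold_def C2_immersion_def C2_map_def o_def)+

text \<open>\<open>tangent_space\<close> collects vectors from all charts around \<open>p\<close>;
  one chart already yields all of them. A vector coming from another chart is the velocity of the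
  image of a coordinate line, and this curve has a lift to the given chart that is continuous at
  time 0, so \<open>velocity_in_range\<close> applies.\<close>

lemma tangent_space_in_chart:
  assumes N: "immersed_submanifold N M" and chart: "(D, \<phi>) \<in> atlas N" and p: "p \<in> D"
    and f': "(inv_into D \<phi> has_derivative f') (at (\<phi> p) within \<phi> ` D)"
    and X: "X \<in> tangent_space N p"
  shows "X \<in> f' ` model N"
proof -
  note man = immersed_submanifoldD[OF N]
  obtain g' v E \<psi> where v: "v \<in> model N" and E: "(E, \<psi>) \<in> atlas N" "p \<in> E"
    and g': "(inv_into E \<psi> has_derivative g') (at (\<psi> p) within \<psi> ` E)" and "X = g' v"
    using X unfolding tangent_space_def by blast
  define \<tau> where "\<tau> = inv_into E \<psi>"
  have \<tau>: "\<tau> (\<psi> q) = q" if "q \<in> E" for q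
    using chart_inj_on[OF man(1) E(1)] that by (simp add: \<tau>_def)
  have \<phi>: "inv_into D \<phi> (\<phi> q) = q" if "q \<in> D" for q
    using chart_inj_on[OF man(1) chart] that by simp
  define c where "c t = \<tau> (\<psi> p + t *\<^sub>R v)" for t :: real
  have c: "(c has_vector_derivative X) (at 0)"
    unfolding c_def \<open>X = g' v\<close>
    using has_vector_derivative_along_line[of "model N" "\<psi> ` E" "\<psi> p" 0 v \<tau> g'] man(3) v E g'
      chart_range_openin[OF man(1) E(1)] by (simp add: \<tau>_def)
  have c0: "c 0 = p"
    using \<tau> E by (simp add: c_def)
  have "openin (topology_of N) (E \<inter> D)"
    using chart_domain_openin man(1) E(1) chart by blast
  then have "openin (top_of_set (model N)) (\<psi> ` (E \<inter> D))"
    using chart_image_openin[OF man(1) E(1)] by blast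
  then obtain \<delta> where \<delta>: "\<delta> > 0" "\<And>t. \<bar>t\<bar> < \<delta> \<Longrightarrow> \<psi> p + t *\<^sub>R v \<in> \<psi> ` (E \<inter> D)"
    using subspace_openin_line[OF man(3) _ _ v] E p by (metis Int_iff image_eqI)
  have cD: "c t \<in> D" if "\<bar>t\<bar> < \<delta>" for t
    using \<delta>(2)[OF that] \<tau> by (auto simp: c_def)
  have ev: "\<forall>\<^sub>F t in at 0. \<bar>t\<bar> < \<delta>"
    using \<delta>(1) unfolding eventually_at by (auto simp: dist_norm)
  have lim: "((\<lambda>t. \<phi> (c t)) \<longlongrightarrow> \<phi> p) (at 0)"
  proof -
    \<comment> \<open>This is the transition map between the two charts.\<close>
    have "continuous_on (\<psi> ` (E \<inter> D)) (\<phi> \<circ> \<tau>)"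
      using man(1) E(1) chart unfolding C2_manifold_def \<tau>_def by (blast intro: C2_on_imp_continuous_on)
    moreover have "continuous_on (ball 0 \<delta>) (\<lambda>t. \<psi> p + t *\<^sub>R v)"
      by (intro continuous_intros)
    ultimately have "continuous_on (ball 0 \<delta>) (\<lambda>t. (\<phi> \<circ> \<tau>) (\<psi> p + t *\<^sub>R v))"
      by (rule continuous_on_compose2) (use \<delta> in \<open>auto simp: dist_norm\<close>)
    then have "isCont (\<lambda>t. \<phi> (c t)) 0"
      using \<delta>(1) by (simp add: c_def continuous_on_eq_continuous_at)
    then show ?thesis
      using c0 by (simp add: isCont_def)
  qed
  \<comment> \<open>The immersion property provides some injective derivative; \<open>f'\<close>
    agrees with it on the model space.\<close>
  have inj: "inj_on f' (model N)"
  proof -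
    obtain h' where h': "(inv_into D \<phi> has_derivative h') (at (\<phi> p) within \<phi> ` D)" "inj_on h' (model N)"
      using man(5)[OF chart] p by blast
    moreover have "h' w = f' w" if "w \<in> model N" for w
      using has_derivative_within_subspace_unique[OF man(3) chart_range_openin[OF man(1) chart] _ that h'(1) f']
        p by blast
    ultimately show ?thesis
      by (simp cong: inj_on_cong)
  qed
  show ?thesis
  proof (rule velocity_in_range[OF man(3) _ imageI[OF p] f' inj _ lim c])
    show "\<phi> ` D \<subseteq> model N"
      using chart_range_openin[OF man(1) chart] by (rule openin_imp_subset)
    show "\<forall>\<^sub>F t in at 0. \<phi> (c t) \<in> \<phi> ` D" "\<forall>\<^sub>F t in at 0. c t = inv_into D \<phi> (\<phi> (c t))"
      using ev by (eventually_elim, simp add: cD \<phi>)+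
    show "c 0 = inv_into D \<phi> (\<phi> p)"
      using c0 \<phi> p by simp
  qed
qed

section \<open>Isotropy of the set of normal lines\<close>

text \<open>In a chart this is the parametrized situation. \<open>G\<close> corresponds to an open
  coordinate ball, hence is open in \<open>S\<close>, and \<open>C\<close> is the image of the
  closed ball of the same radius, hence compact.\<close>

lemma normal_lines_locally_isotropic:
  fixes S :: "('a::euclidean_space, 'k::euclidean_space) manifold"
  assumes S: "immersed_submanifold S M" and \<nu>: "unit_normal_section S \<nu>" and q: "q \<in> points S"
  obtains G C where "openin (topology_of S) G" "q \<in> G" "compact C" "isotropic_along_curves C"
    "normal_lines \<nu> ` G \<subseteq> C"
proof -
  note man = immersed_submanifoldD[OF S]
  obtain E \<phi> where E: "(E, \<phi>) \<in> atlas S" "q \<in> E"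
    using C2_manifold_chart_at[OF man(1) q] by blast
  note inj = chart_inj_on[OF man(1) E(1)]
  define \<sigma> where "\<sigma> = inv_into E \<phi>"
  have \<sigma>_in: "\<sigma> y \<in> E" "\<phi> (\<sigma> y) = y" if "y \<in> \<phi> ` E" for y
    using that by (simp_all add: \<sigma>_def inv_into_into f_inv_into_f)
  have E_points: "E \<subseteq> points S"
    using chart_domain_openin[OF man(1) E(1)] by (rule openin_subset)
  have U: "openin (top_of_set (model S)) (\<phi> ` E)"
    using chart_range_openin[OF man(1) E(1)] .
  obtain F' :: "'k \<Rightarrow> 'k \<Rightarrow>\<^sub>L ('a \<times> 'a)" where F': "continuous_on (\<phi> ` E) F'"
    "\<And>y. y \<in> \<phi> ` E \<Longrightarrow> ((\<lambda>y. ((\<nu> \<circ> \<sigma>) y, \<sigma> y - ((\<nu> \<circ> \<sigma>) y \<bullet> \<sigma> y) *\<^sub>R (\<nu> \<circ> \<sigma>) y))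
      has_derivative F' y) (at y within \<phi> ` E)"
    "\<And>y. y \<in> \<phi> ` E \<Longrightarrow> inj_on (F' y) (model S)"
    "\<And>p y a b. \<lbrakk>y \<in> \<phi> ` E; a \<in> model S; b \<in> model S\<rbrakk> \<Longrightarrow> \<Omega> p (F' y a) (F' y b) = 0"
  proof (rule normal_lines_parametrized[OF man(3) U])
    show "C2_on (\<phi> ` E) \<sigma>"
      using man(4) E by (simp add: \<sigma>_def)
    show "C2_on (\<phi> ` E) (\<nu> \<circ> \<sigma>)"
      using \<nu> E unfolding unit_normal_section_def C2_map_def \<sigma>_def by blast
    show "norm ((\<nu> \<circ> \<sigma>) y) = 1" if "y \<in> \<phi> ` E" for y
      using \<nu> \<sigma>_in[OF that] E_points unfolding unit_normal_section_def by auto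
    show "(\<nu> \<circ> \<sigma>) y \<bullet> f' a = 0"
      if "y \<in> \<phi> ` E" "a \<in> model S" "(\<sigma> has_derivative f') (at y within \<phi> ` E)" for y f' a
    proof -
      have "f' a \<in> tangent_space S (\<sigma> y)"
        unfolding tangent_space_def using that \<sigma>_in[OF that(1)] E(1)
        by (intro CollectI exI[of _ f'] exI[of _ a] conjI refl bexI[of _ "(E, \<phi>)"]) (auto simp: \<sigma>_def)
      then show ?thesis
        using \<nu> \<sigma>_in[OF that(1)] E_points unfolding unit_normal_section_def by auto
    qed
    show "\<exists>f'. (\<sigma> has_derivative f') (at y within \<phi> ` E) \<and> inj_on f' (model S)" if "y \<in> \<phi> ` E" for y
      using man(5)[OF E(1) that] by (simp add: \<sigma>_def)
  qed blast
  have F: "((normal_lines \<nu> \<circ> \<sigma>) has_derivative F' y) (at y within \<phi> ` E)" if "y \<in> \<phi> ` E" for y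
    using F'(2)[OF that] by (simp add: normal_lines_def o_def)
  obtain r where r: "r > 0" "model S \<inter> cball (\<phi> q) r \<subseteq> \<phi> ` E"
    "compact ((normal_lines \<nu> \<circ> \<sigma>) ` (model S \<inter> cball (\<phi> q) r))"
    "isotropic_along_curves ((normal_lines \<nu> \<circ> \<sigma>) ` (model S \<inter> cball (\<phi> q) r))"
    using isotropic_immersion_local_image[OF man(3) U _ F F'(1,3,4)] E(2) by blast
  define G where "G = {p \<in> E. \<phi> p \<in> model S \<inter> ball (\<phi> q) r}"
  have "openin (topology_of S) G"
    unfolding G_def by (rule chart_preimage_openin[OF man(1) E(1)]) auto
  moreover have \<phi>E: "\<phi> ` E \<subseteq> model S"
    using U by (rule openin_imp_subset)
  then have "q \<in> G"
    using E(2) r(1) by (auto simp: G_def)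
  moreover have "normal_lines \<nu> ` G \<subseteq> (normal_lines \<nu> \<circ> \<sigma>) ` (model S \<inter> cball (\<phi> q) r)"
  proof (rule image_subsetI)
    fix p assume p: "p \<in> G"
    then have "\<sigma> (\<phi> p) = p"
      using inj by (simp add: G_def \<sigma>_def)
    then show "normal_lines \<nu> p \<in> (normal_lines \<nu> \<circ> \<sigma>) ` (model S \<inter> cball (\<phi> q) r)"
      using p by (intro image_eqI[of _ _ "\<phi> p"]) (auto simp: G_def)
  qed
  ultimately show ?thesis
    using that r(3,4) by blast
qed

text \<open>The topology of \<open>S\<close> is second countable, hence Lindelof, so countably many
  of the local pieces suffice.\<close>

lemma normal_lines_countable_isotropic_cover:
  fixes S :: "('a::euclidean_space, 'k::euclidean_space) manifold"
  assumes S: "immersed_submanifold S M" and \<nu>: "unit_normal_section S \<nu>"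
  obtains \<C> where "countable \<C>" "\<And>C. C \<in> \<C> \<Longrightarrow> compact C \<and> isotropic_along_curves C"
    "normal_lines \<nu> ` points S \<subseteq> \<Union>\<C>"
proof -
  define \<G> where "\<G> = {G. openin (topology_of S) G \<and>
    (\<exists>C. compact C \<and> isotropic_along_curves C \<and> normal_lines \<nu> ` G \<subseteq> C)}"
  have "\<Union>\<G> = points S"
  proof
    show "\<Union>\<G> \<subseteq> points S"
      using openin_subset by (fastforce simp: \<G>_def)
    show "points S \<subseteq> \<Union>\<G>"
    proof
      fix q assume "q \<in> points S"
      then obtain G C where "openin (topology_of S) G" "q \<in> G" "compact C" "isotropic_along_curves C"
        "normal_lines \<nu> ` G \<subseteq> C"
        by (rule normal_lines_locally_isotropic[OF S \<nu>])
      then show "q \<in> \<Union>\<G>"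
        unfolding \<G>_def by blast
    qed
  qed
  moreover have "Lindelof_space (topology_of S)"
    using immersed_submanifoldD(1)[OF S] second_countable_imp_Lindelof_space
    unfolding C2_manifold_def by blast
  ultimately obtain \<H> where \<H>: "countable \<H>" "\<H> \<subseteq> \<G>" "\<Union>\<H> = points S"
    using Lindelof_spaceD[of "topology_of S" \<G>] by (auto simp: \<G>_def)
  have "\<forall>G\<in>\<H>. \<exists>C. compact C \<and> isotropic_along_curves C \<and> normal_lines \<nu> ` G \<subseteq> C"
    using \<H>(2) by (auto simp: \<G>_def)
  then obtain P where P: "\<And>G. G \<in> \<H> \<Longrightarrow> compact (P G) \<and> isotropic_along_curves (P G) \<and> normal_lines \<nu> ` G \<subseteq> P G"
    by metis
  show ?thesis
  proof
    show "countable (P ` \<H>)"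
      using \<H>(1) by simp
    show "compact C \<and> isotropic_along_curves C" if "C \<in> P ` \<H>" for C
      using P that by blast
    show "normal_lines \<nu> ` points S \<subseteq> \<Union>(P ` \<H>)"
    proof (rule image_subsetI)
      fix q assume "q \<in> points S"
      then obtain G where G: "G \<in> \<H>" "q \<in> G"
        using \<H>(3) by blast
      then have "normal_lines \<nu> q \<in> P G"
        using P[OF G(1)] by blast
      then show "normal_lines \<nu> q \<in> \<Union>(P ` \<H>)"
        using G(1) by blast
    qed
  qed
qed

section \<open>Baire category argument\<close>

text \<open>If \<open>\<Omega>\<close> were non-zero on some pair of tangent vectors, it would be so
  on an open set of coordinates. By Baire's theorem one of the countably many closed pieces covering
  this set has an interior point. Short coordinate lines through that point run inside the piece, so
  \<open>\<Omega>\<close> vanishes on their velocities, a contradiction.\<close>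

lemma isotropic_if_countable_isotropic_cover:
  fixes \<Gamma> :: "('a::euclidean_space \<times> 'a, 'm::euclidean_space) manifold"
  assumes \<Gamma>: "immersed_submanifold \<Gamma> TSn"
    and \<C>: "countable \<C>" "\<And>C. C \<in> \<C> \<Longrightarrow> compact C \<and> isotropic_along_curves C" "points \<Gamma> \<subseteq> \<Union>\<C>"
  shows "isotropic \<Gamma>"
  unfolding isotropic_def
proof (intro conjI ballI \<Gamma>)
  fix p X Y
  assume p: "p \<in> points \<Gamma>" and X: "X \<in> tangent_space \<Gamma> p" and Y: "Y \<in> tangent_space \<Gamma> p"
  note man = immersed_submanifoldD[OF \<Gamma>]
  obtain D \<phi> where D: "(D, \<phi>) \<in> atlas \<Gamma>" "p \<in> D"
    using C2_manifold_chart_at[OF man(1) p] by blast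
  define \<tau> where "\<tau> = inv_into D \<phi>"
  define W where "W = \<phi> ` D"
  have W: "openin (top_of_set (model \<Gamma>)) W"
    unfolding W_def by (rule chart_range_openin[OF man(1) D(1)])
  have C2: "C2_on W \<tau>"
    using man(4)[OF D(1)] by (simp add: W_def \<tau>_def)
  then obtain \<tau>' where \<tau>': "\<And>x. x \<in> W \<Longrightarrow> (\<tau> has_derivative blinfun_apply (\<tau>' x)) (at x within W)"
    and cont': "continuous_on W \<tau>'"
    using C2_on_imp_C1 by blast
  have cont: "continuous_on W \<tau>"
    using C2 by (rule C2_on_imp_continuous_on)
  have \<phi>p: "\<phi> p \<in> W" "\<tau> (\<phi> p) = p"
    using D chart_inj_on[OF man(1) D(1)] by (auto simp: W_def \<tau>_def)
  obtain v w where v: "v \<in> model \<Gamma>" "X = \<tau>' (\<phi> p) v" and w: "w \<in> model \<Gamma>" "Y = \<tau>' (\<phi> p) w"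
    using tangent_space_in_chart[OF \<Gamma> D] \<tau>'[OF \<phi>p(1)] X Y unfolding W_def \<tau>_def by blast
  \<comment> \<open>\<open>X\<close> and \<open>Y\<close> are extended to vector fields with
    constant coordinates \<open>v\<close> and \<open>w\<close>, which makes
    \<open>\<Omega> p X Y\<close> the value at \<open>\<phi> p\<close> of a continuous function on
    \<open>W\<close>.\<close>
  define \<omega> where "\<omega> x = \<Omega> (\<tau> x) (\<tau>' x v) (\<tau>' x w)" for x
  have "continuous_on W \<omega>"
    unfolding \<omega>_def \<Omega>_eq using cont' by (intro continuous_intros)
  define W' where "W' = {x \<in> W. \<omega> x \<noteq> 0}"
  have "W' = W \<inter> \<omega> -` (- {0})"
    by (auto simp: W'_def)
  then have "openin (top_of_set W) W'"
    using \<open>continuous_on W \<omega>\<close> by (simp add: continuous_openin_preimage_gen open_Compl)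
  then have W': "openin (top_of_set (model \<Gamma>)) W'"
    using W openin_trans by blast
  have "W' = {}"
  proof (rule ccontr)
    assume "W' \<noteq> {}"
    define piece where "piece C = {x \<in> W'. \<tau> x \<in> C}" for C
    have W'W: "W' \<subseteq> W"
      by (auto simp: W'_def)
    \<comment> \<open>Closedness holds in coordinates: \<open>\<tau>\<close> is continuous as a map
      into the Euclidean space, in which \<open>C\<close> is compact.\<close>
    have closed: "closedin (top_of_set W') (piece C)" if "C \<in> \<C>" for C
    proof -
      have "piece C = W' \<inter> \<tau> -` C"
        by (auto simp: piece_def)
      moreover have "closed C"
        using \<C>(2) that compact_imp_closed by blast
      ultimately show ?thesis
        using continuous_on_subset[OF cont W'W] by (simp add: continuous_closedin_preimage)
    qed
    have "\<tau> x \<in> points \<Gamma>" if "x \<in> W" for x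
      using that openin_subset[OF chart_domain_openin[OF man(1) D(1)]] inv_into_into[of x \<phi> D]
      unfolding W_def \<tau>_def by blast
    then have cover: "\<Union>(piece ` \<C>) = W'"
      using \<C>(3) by (fastforce simp: piece_def W'_def)
    \<comment> \<open>The model space is closed in a Euclidean space and \<open>W'\<close> is open
      in the model space, so Baire's theorem is available on \<open>W'\<close>.\<close>
    have "completely_metrizable_space (top_of_set (model \<Gamma>))"
      using man(3) by (simp add: completely_metrizable_space_closedin completely_metrizable_space_euclidean
          closed_subspace)
    then have "completely_metrizable_space (top_of_set W')"
      using completely_metrizable_space_openin[OF _ W'] openin_imp_subset[OF W']
      by (simp add: subtopology_subtopology Int_absorb1)
    moreover have "top_of_set W' interior_of \<Union>(piece ` \<C>) \<noteq> {}"
      using cover \<open>W' \<noteq> {}\<close> by (metis interior_of_topspace topspace_euclidean_subtopology)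
    ultimately have "\<not> (\<forall>T\<in>piece ` \<C>. closedin (top_of_set W') T \<and> top_of_set W' interior_of T = {})"
      using Baire_category_alt[of "top_of_set W'" "piece ` \<C>"] \<C>(1) by auto
    then obtain C where C: "C \<in> \<C>" "top_of_set W' interior_of piece C \<noteq> {}"
      using closed by blast
    define O' where "O' = top_of_set W' interior_of piece C"
    have "openin (top_of_set W') O'"
      by (simp add: O'_def)
    then have O': "openin (top_of_set (model \<Gamma>)) O'"
      using W' openin_trans by blast
    have O'C: "x \<in> W'" "\<tau> x \<in> C" if "x \<in> O'" for x
      using that interior_of_subset[of "top_of_set W'" "piece C"] by (auto simp: O'_def piece_def)
    obtain x where x: "x \<in> O'"
      using C(2) by (auto simp: O'_def)
    have xW: "x \<in> W"
      using O'C(1)[OF x] W'W by blast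
    \<comment> \<open>Every direction of the model space is allowed because \<open>O'\<close> is
      open there; \<open>v\<close> and \<open>w\<close> are the ones used.\<close>
    have curve: "((\<lambda>t. \<tau> (x + t *\<^sub>R u)) has_vector_derivative \<tau>' x u) (at 0)"
      "\<forall>\<^sub>F t in at (0::real). \<tau> (x + t *\<^sub>R u) \<in> C" if u: "u \<in> model \<Gamma>" for u
    proof -
      show "((\<lambda>t. \<tau> (x + t *\<^sub>R u)) has_vector_derivative \<tau>' x u) (at 0)"
        using has_vector_derivative_along_line[OF man(3) W _ u, of x 0 \<tau> "\<tau>' x"] \<tau>'[OF xW] xW by simp
      obtain \<delta> where "\<delta> > 0" "\<And>t. \<bar>t\<bar> < \<delta> \<Longrightarrow> x + t *\<^sub>R u \<in> O'"
        using subspace_openin_line[OF man(3) O' x u] by blast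
      then show "\<forall>\<^sub>F t in at (0::real). \<tau> (x + t *\<^sub>R u) \<in> C"
        using O'C(2) unfolding eventually_at by (auto simp: dist_norm)
    qed
    have "isotropic_along_curves C"
      using \<C>(2) C(1) by blast
    then have "\<omega> x = 0"
      using isotropic_along_curvesD[OF _ _ curve(1)[OF v(1)] curve(1)[OF w(1)] curve(2)[OF v(1)] curve(2)[OF w(1)]]
      by (simp add: \<omega>_def)
    then show False
      using O'C(1)[OF x] by (simp add: W'_def)
  qed
  then show "\<Omega> p X Y = 0"
    using \<phi>p v w by (auto simp: W'_def \<omega>_def)
qed

theorem proposition4:
  fixes S :: "('a::euclidean_space, 'k::euclidean_space) manifold"
    and \<Gamma> :: "('a \<times> 'a, 'm::euclidean_space) manifold"
    and \<nu> :: "'a \<Rightarrow> 'a"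
  assumes "immersed_submanifold S UNIV"
    and "mdim S > 0"
    and "unit_normal_section S \<nu>"
    and "immersed_submanifold \<Gamma> TSn"
    and "points \<Gamma> = normal_lines \<nu> ` points S"
  shows "orthogonal_submanifold S \<Gamma> \<and> isotropic \<Gamma>"
proof
  show "orthogonal_submanifold S \<Gamma>"
    using assms unfolding orthogonal_submanifold_def by blast
  obtain \<C> where "countable \<C>" "\<And>C. C \<in> \<C> \<Longrightarrow> compact C \<and> isotropic_along_curves C"
    "points \<Gamma> \<subseteq> \<Union>\<C>"
    using normal_lines_countable_isotropic_cover[OF assms(1,3)] assms(5) by metis
  then show "isotropic \<Gamma>"
    using isotropic_if_countable_isotropic_cover[OF assms(4)] by blast
qed

end
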